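(* Let $U$ be a (complex) Hermitian $l\times l$ matrix all of whose diagonal entries equal $1$, let $D=\operatorname{diag}(d_1,\dots,d_l)$ with real $d_i$ satisfying $1\le d_i\le 2$ for every $i$, and let $G=D^{1/2}UD^{1/2}$. If $\tau\ge 0$ and $c$ are real numbers with $c\ge\max\left(1+\tau,\,2+\tau/2\right)$, then $$\operatorname{tr}\varphi_c(G)-\operatorname{tr}D^2\ \ge\ \operatorname{tr}\Psi_\tau(U).$$
   Context: For a Hermitian matrix $X$ and a function $f:\mathbb R\to\mathbb R$, write $\operatorname{tr}f(X)=\sum_i f(\lambda_i(X))$, where the $\lambda_i(X)$ are the eigenvalues of $X$ listed with multiplicity. For real $c$ and real $\tau\ge 0$ define functions $\mathbb R\to\mathbb R$ by $$\varphi_c(x)=\begin{cases}x^2,&x\le c,\\ 2cx-c^2,&x>c,\end{cases}\qquad \Psi_\tau(x)=\begin{cases}(x-1)^2,&x\le 1+\tau,\\ 2\tau(x-1)-\tau^2,&x>1+\tau.\end{cases}$$ $D^{1/2}$ denotes $\operatorname{diag}(\sqrt{d_1},\dots,\sqrt{d_l})$. The matrix $U$ is not assumed to be positive semidefinite. *)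

theory Defs
  imports "Jordan_Normal_Form.Schur_Decomposition"
begin

definition phi :: "real \<Rightarrow> real \<Rightarrow> real" where
  "phi c x = (if x \<le> c then x\<^sup>2 else 2 * c * x - c\<^sup>2)"

definition Psi :: "real \<Rightarrow> real \<Rightarrow> real" where
  "Psi \<tau> x = (if x \<le> 1 + \<tau> then (x - 1)\<^sup>2 else 2 * \<tau> * (x - 1) - \<tau>\<^sup>2)"

definition hermitian_mat :: "complex mat \<Rightarrow> bool" where
  "hermitian_mat A \<longleftrightarrow> square_mat A \<and> mat_adjoint A = A"

(* Only meant for Hermitian X: all eigenvalues are then real, so Re merely converts
   them to type real.  proots counts each root of the characteristic polynomial with its
   multiplicity; over the complex numbers it therefore has as many elements as X has rows. *)
definition tr_fun :: "(real \<Rightarrow> real) \<Rightarrow> complex mat \<Rightarrow> real" where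
  "tr_fun f X = (\<Sum>z \<in># proots (char_poly X). f (Re z))"

definition mat_trace :: "'a :: comm_monoid_add mat \<Rightarrow> 'a" where
  "mat_trace A = sum_list (diag_mat A)"

definition real_diag :: "nat \<Rightarrow> (nat \<Rightarrow> real) \<Rightarrow> complex mat" where
  "real_diag n d = mat_diag n (\<lambda>i. complex_of_real (d i))"

end

theory Submission
  imports Defs
begin

text \<open>
  Since \<open>phi c x\<close> is the maximum of \<open>2 z x - z\<^sup>2\<close> over \<open>z \<le> c\<close>, every matrix \<open>Z \<le> c I\<close> satisfies
  \<open>tr phi\<^sub>c(G) \<ge> 2 tr(Z G) - tr Z\<^sup>2\<close>; dually, \<open>tr Psi\<^sub>\<tau>(U) = 2 tr(W (U - I)) - tr W\<^sup>2\<close> for the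
  spectral truncation \<open>W = min(U - I, \<tau>)\<close>. Take \<open>Z = D + D\<^sup>-\<^sup>1\<^sup>/\<^sup>2 W D\<^sup>-\<^sup>1\<^sup>/\<^sup>2\<close>. Then \<open>Z \<le> D + \<tau> D\<^sup>-\<^sup>1\<close>, which
  is at most \<open>c I\<close> because the convex function \<open>d + \<tau>/d\<close> is maximal at an end point of \<open>[1, 2]\<close>. As
  \<open>G - D = D\<^sup>1\<^sup>/\<^sup>2 (U - I) D\<^sup>1\<^sup>/\<^sup>2\<close> has zero diagonal, \<open>2 tr(Z G) - tr Z\<^sup>2 - tr D\<^sup>2\<close> equals
  \<open>2 tr(W (U - I)) - tr(D\<^sup>-\<^sup>1 W D\<^sup>-\<^sup>1 W)\<close>, and the last trace is at most \<open>tr W\<^sup>2\<close> because \<open>D \<ge> I\<close>.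
\<close>

section \<open>Adjoints and Hermitian matrices\<close>

lemma mat_adjoint_dim [simp]:
  "dim_row (mat_adjoint A) = dim_col A" "dim_col (mat_adjoint A) = dim_row A"
  by (simp_all add: mat_adjoint_def)

lemma mat_adjoint_carrier [simp]:
  "A \<in> carrier_mat n m \<Longrightarrow> mat_adjoint A \<in> carrier_mat m n"
  by auto

lemma square_mult_carrier [simp]:
  "A \<in> carrier_mat n n \<Longrightarrow> B \<in> carrier_mat n n \<Longrightarrow> A * B \<in> carrier_mat n n"
  by (rule mult_carrier_mat)

lemma square_mult_assoc:
  fixes A B C :: "complex mat"
  assumes "A \<in> carrier_mat n n" "B \<in> carrier_mat n n" "C \<in> carrier_mat n n"
  shows "A * B * C = A * (B * C)"
  using assms by (rule assoc_mult_mat)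

lemma mat_adjoint_index [simp]:
  "i < dim_col A \<Longrightarrow> j < dim_row A \<Longrightarrow> mat_adjoint A $$ (i, j) = conjugate (A $$ (j, i))"
  by (simp add: mat_adjoint_def mat_of_rows_index)

lemma mat_adjoint_adjoint [simp]: "mat_adjoint (mat_adjoint A) = A"
  by (rule eq_matI) auto

lemma mat_adjoint_mult:
  fixes A B :: "complex mat"
  assumes "A \<in> carrier_mat n m" "B \<in> carrier_mat m k"
  shows "mat_adjoint (A * B) = mat_adjoint B * mat_adjoint A"
proof (rule eq_matI)
  fix i j assume "i < dim_row (mat_adjoint B * mat_adjoint A)" "j < dim_col (mat_adjoint B * mat_adjoint A)"
  then show "mat_adjoint (A * B) $$ (i, j) = (mat_adjoint B * mat_adjoint A) $$ (i, j)"
    using assms by (simp add: scalar_prod_def mult.commute)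
qed (use assms in auto)

lemma hermitian_matI:
  assumes "A \<in> carrier_mat n n"
    and "\<And>i j. i < n \<Longrightarrow> j < n \<Longrightarrow> A $$ (i, j) = cnj (A $$ (j, i))"
  shows "hermitian_mat A"
  unfolding hermitian_mat_def
proof
  show "square_mat A" using assms(1) by auto
  show "mat_adjoint A = A"
  proof (rule eq_matI)
    fix i j assume "i < dim_row A" "j < dim_col A"
    then show "mat_adjoint A $$ (i, j) = A $$ (i, j)"
      using assms(1) assms(2)[of i j] by auto
  qed (use assms(1) in auto)
qed

lemma hermitian_mat_index:
  assumes "hermitian_mat A" "A \<in> carrier_mat n n" "i < n" "j < n"
  shows "A $$ (i, j) = cnj (A $$ (j, i))"
  using assms mat_adjoint_index[of i A j] by (simp add: hermitian_mat_def)

lemma hermitian_mat_conj: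
  assumes "hermitian_mat A" "A \<in> carrier_mat n n" "W \<in> carrier_mat n n"
  shows "hermitian_mat (mat_adjoint W * A * W)"
proof -
  have "mat_adjoint (mat_adjoint W * A * W) = mat_adjoint W * (A * W)"
    using assms by (simp add: mat_adjoint_mult[where n=n and m=n and k=n] hermitian_mat_def)
  also have "\<dots> = mat_adjoint W * A * W"
    using assms by (simp add: square_mult_assoc[where n=n])
  finally show ?thesis using assms by (simp add: hermitian_mat_def)
qed

section \<open>Unitary matrices and the spectral theorem\<close>

definition unitary_mat :: "nat \<Rightarrow> complex mat \<Rightarrow> bool" where
  "unitary_mat n V \<longleftrightarrow> V \<in> carrier_mat n n \<and> mat_adjoint V * V = 1\<^sub>m n \<and> V * mat_adjoint V = 1\<^sub>m n"

lemma unitary_matI: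
  assumes "V \<in> carrier_mat n n" "mat_adjoint V * V = 1\<^sub>m n"
  shows "unitary_mat n V"
  using assms mat_mult_left_right_inverse[of "mat_adjoint V" n V] by (simp add: unitary_mat_def)

lemma unitary_mat_mult:
  assumes V: "unitary_mat n V" and W: "unitary_mat n W"
  shows "unitary_mat n (V * W)"
proof (rule unitary_matI)
  have c: "V \<in> carrier_mat n n" "W \<in> carrier_mat n n"
    using V W by (auto simp: unitary_mat_def)
  then show "V * W \<in> carrier_mat n n" by simp
  have "mat_adjoint (V * W) * (V * W) = mat_adjoint W * ((mat_adjoint V * V) * W)"
    using c by (simp add: mat_adjoint_mult[OF c] square_mult_assoc[where n=n])
  then show "mat_adjoint (V * W) * (V * W) = 1\<^sub>m n"
    using V W c by (simp add: unitary_mat_def)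
qed

lemma unitary_mat_cancel:
  assumes V: "unitary_mat n V" and A: "A \<in> carrier_mat n n"
  shows "V * (mat_adjoint V * A * V) * mat_adjoint V = A"
proof -
  have c: "V \<in> carrier_mat n n"
    using V by (auto simp: unitary_mat_def)
  have "V * (mat_adjoint V * A * V) * mat_adjoint V
    = (V * mat_adjoint V) * A * (V * mat_adjoint V)"
    using c A by (simp add: square_mult_assoc[where n=n])
  then show ?thesis
    using V A by (simp add: unitary_mat_def)
qed

text \<open>Supplies the deflation step of the spectral theorem. Over the complex numbers some
  eigenvector exists; it is completed to a basis, orthogonalised with the eigenvector kept in first
  place, and the resulting vectors are normalised to form the columns of \<open>W\<close>.\<close>

lemma unitary_with_eigenvector_column:
  fixes A :: "complex mat"
  assumes A: "A \<in> carrier_mat n n" and n: "n > 0"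
  obtains W e where "unitary_mat n W" "A *\<^sub>v col W 0 = e \<cdot>\<^sub>v col W 0"
proof -
  obtain as where as: "char_poly A = (\<Prod>a\<leftarrow>as. [:- a, 1:])" "length as = n"
    using char_poly_factorized[OF A] by blast
  \<comment> \<open>\<open>hd as\<close> is a genuine root because \<open>n > 0\<close> makes
    \<open>as\<close> nonempty.\<close>
  then have "poly (char_poly A) (hd as) = 0"
    using n by (cases as) auto
  then have "eigenvalue A (hd as)"
    using eigenvalue_root_char_poly[OF A] by blast
  then obtain e v where ev: "eigenvector A v e"
    unfolding eigenvalue_def by blast
  then have v: "v \<in> carrier_vec n" and v0: "v \<noteq> 0\<^sub>v n" and eigen: "A *\<^sub>v v = e \<cdot>\<^sub>v v"
    using A by (auto simp: eigenvector_def)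
  interpret cof_vec_space n "TYPE(complex)" .
  define b where "b = basis_completion v"
  define ws where "ws = gram_schmidt n b"
  from basis_completion[OF v v0, folded b_def]
  have "distinct b" "\<not> lin_dep (set b)" and b: "set b \<subseteq> carrier_vec n"
    and hdb: "hd b = v" and len_b: "length b = n" by auto
  from gram_schmidt_result[OF b this(1,2) refl, folded ws_def]
  have ws: "set ws \<subseteq> carrier_vec n" "corthogonal ws" "length ws = n"
    by (auto simp: len_b)
  from hdb len_b n obtain vs where bv: "b = v # vs" by (cases b) auto
  from gram_schmidt_hd[OF v, of vs, folded bv] have "hd ws = v"
    unfolding ws_def .
  then have ws0: "ws ! 0 = v"
    using n ws(3) by (cases ws) auto
  \<comment> \<open>Gram-Schmidt yields orthogonal vectors that need not have norm 1;
    \<open>r j\<close> is the reciprocal of the norm of \<open>ws ! j\<close>. Being real, it is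
    unchanged by conjugation.\<close>
  define r where "r j = inverse (complex_of_real (sqrt (Re (ws ! j \<bullet>c ws ! j))))" for j
  define W where "W = mat n n (\<lambda>(i, j). r j * ws ! j $ i)"
  have W: "W \<in> carrier_mat n n" by (simp add: W_def)
  have wsc: "ws ! j \<in> carrier_vec n" if "j < n" for j
    using ws that by auto
  have rr: "cnj (r j) = r j" for j by (simp add: r_def)
  have orth: "ws ! j \<bullet>c ws ! i = (if i = j then inverse (r i * r j) else 0)" if "i < n" "j < n" for i j
  proof (cases "i = j")
    case True
    have "ws ! i \<bullet>c ws ! i \<ge> 0"
      by (rule conjugate_square_ge_0_vec)
    then have "ws ! i \<bullet>c ws ! i = complex_of_real (Re (ws ! i \<bullet>c ws ! i))" "Re (ws ! i \<bullet>c ws ! i) \<ge> 0"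
      by (auto simp: less_eq_complex_def complex_eq_iff)
    then show ?thesis
      using True by (simp add: r_def flip: of_real_mult)
  next
    case False
    then show ?thesis
      using ws that corthogonalD[of ws j i] by auto
  qed
  have r0: "r i \<noteq> 0" if "i < n" for i
    using orth[OF that that] ws that corthogonalD[of ws i i] by auto
  have "mat_adjoint W * W = 1\<^sub>m n"
  proof (rule eq_matI)
    fix i j assume ij: "i < dim_row (1\<^sub>m n :: complex mat)" "j < dim_col (1\<^sub>m n :: complex mat)"
    then have *: "i < n" "j < n" by auto
    have "(mat_adjoint W * W) $$ (i, j) = (\<Sum>k<n. r i * r j * (ws ! j $ k * cnj (ws ! i $ k)))"
      using * by (auto simp: W_def scalar_prod_def rr atLeast0LessThan mult_ac intro!: sum.cong)
    also have "\<dots> = r i * r j * (ws ! j \<bullet>c ws ! i)"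
      using * wsc[of i] wsc[of j]
      by (auto simp: scalar_prod_def sum_distrib_left atLeast0LessThan intro!: sum.cong)
    also have "\<dots> = 1\<^sub>m n $$ (i, j)"
      using * r0[of j] by (auto simp: orth field_simps)
    finally show "(mat_adjoint W * W) $$ (i, j) = 1\<^sub>m n $$ (i, j)" .
  qed (use W in auto)
  then have "unitary_mat n W"
    using W by (intro unitary_matI)
  moreover have "col W 0 = r 0 \<cdot>\<^sub>v v"
    using n v ws0 by (intro eq_vecI) (auto simp: W_def)
  then have "A *\<^sub>v col W 0 = e \<cdot>\<^sub>v col W 0"
    using A v eigen by (simp add: mult_mat_vec smult_smult_assoc mult.commute)
  ultimately show ?thesis ..
qed

lemma real_diag_carrier [simp]: "real_diag n f \<in> carrier_mat n n"
  by (simp add: real_diag_def)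

lemma mult_block_diag:
  fixes A B C D :: "'a :: semiring_0 mat"
  assumes "A \<in> carrier_mat m m" "B \<in> carrier_mat m m" "C \<in> carrier_mat n n" "D \<in> carrier_mat n n"
  shows "four_block_mat A (0\<^sub>m m n) (0\<^sub>m n m) C * four_block_mat B (0\<^sub>m m n) (0\<^sub>m n m) D
    = four_block_mat (A * B) (0\<^sub>m m n) (0\<^sub>m n m) (C * D)"
  using assms by (subst mult_four_block_mat[of _ m m _ n _ n _ _ m _ n]) auto

text \<open>Induction by deflation: conjugation with a unitary matrix whose first column is an
  eigenvector clears the rest of the first column, Hermitian symmetry then clears the first row, and
  the induction hypothesis diagonalises the remaining block.\<close>

lemma hermitian_spectral:
  assumes "A \<in> carrier_mat n n" "hermitian_mat A"
  shows "\<exists>V f. unitary_mat n V \<and> A = V * real_diag n f * mat_adjoint V"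
  using assms
proof (induction n arbitrary: A)
  case 0
  have "unitary_mat 0 (1\<^sub>m 0)" by (rule unitary_matI) auto
  moreover have "A = 1\<^sub>m 0 * real_diag 0 f * mat_adjoint (1\<^sub>m 0)" for f
    using 0 by (intro eq_matI) auto
  ultimately show ?case by blast
next
  case (Suc n)
  let ?N = "Suc n"
  obtain W e where W: "unitary_mat ?N W" and ev: "A *\<^sub>v col W 0 = e \<cdot>\<^sub>v col W 0"
    using unitary_with_eigenvector_column[OF Suc.prems(1)] by blast
  have Wc: "W \<in> carrier_mat ?N ?N" using W by (simp add: unitary_mat_def)
  define A' where "A' = mat_adjoint W * A * W"
  have A'c: "A' \<in> carrier_mat ?N ?N" using Wc Suc.prems by (auto simp: A'_def)
  have A'h: "hermitian_mat A'"
    unfolding A'_def using Suc.prems Wc by (intro hermitian_mat_conj)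
  have "A' = mat_adjoint W * (A * W)"
    unfolding A'_def using Wc Suc.prems(1) by (simp add: square_mult_assoc[where n="?N"])
  then have "col A' 0 = mat_adjoint W *\<^sub>v col (A * W) 0"
    using Wc Suc.prems(1) by (simp add: col_mult2[of _ ?N ?N _ ?N])
  also have "col (A * W) 0 = A *\<^sub>v col W 0"
    using Wc Suc.prems(1) by (intro eq_vecI) auto
  also have "mat_adjoint W *\<^sub>v (A *\<^sub>v col W 0) = e \<cdot>\<^sub>v (mat_adjoint W *\<^sub>v col W 0)"
    unfolding ev using Wc by (intro mult_mat_vec[of _ ?N ?N]) (auto intro!: carrier_vecI)
  also have "mat_adjoint W *\<^sub>v col W 0 = col (mat_adjoint W * W) 0"
    using Wc by (intro eq_vecI) auto
  finally have col0: "col A' 0 = e \<cdot>\<^sub>v col (1\<^sub>m ?N) 0"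
    using W by (simp add: unitary_mat_def)
  have A'0: "A' $$ (i, 0) = (if i = 0 then e else 0)" if "i < ?N" for i
    using arg_cong[OF col0, of "\<lambda>v. v $ i"] that A'c by auto
  have A'0': "A' $$ (0, i) = (if i = 0 then cnj e else 0)" if "i < ?N" for i
    using hermitian_mat_index[OF A'h A'c, of 0 i] that by (simp add: A'0)
  \<comment> \<open>The corner entry belongs to both the first column and the first row, which
    forces the eigenvalue to be real; this is what lets it enter a \<open>real_diag\<close>.\<close>
  from A'0[of 0] A'0'[of 0] have "e = cnj e" by simp
  then have e: "e = of_real (Re e)" by (auto simp: complex_eq_iff)
  define A3 where "A3 = mat n n (\<lambda>(i, j). A' $$ (Suc i, Suc j))"
  have A3c: "A3 \<in> carrier_mat n n" by (simp add: A3_def)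
  have "hermitian_mat A3"
    by (rule hermitian_matI[OF A3c]) (auto simp: A3_def hermitian_mat_index[OF A'h A'c, symmetric])
  with Suc.IH[OF A3c] obtain V f where V: "unitary_mat n V"
    and A3: "A3 = V * real_diag n f * mat_adjoint V" by blast
  have Vc: "V \<in> carrier_mat n n" using V by (simp add: unitary_mat_def)
  \<comment> \<open>\<open>P\<close> fixes the first coordinate and diagonalises the other
    \<open>n\<close>; correspondingly \<open>g\<close> puts the eigenvalue split off above in front
    of \<open>f\<close>.\<close>
  define P where "P = four_block_mat (1\<^sub>m 1) (0\<^sub>m 1 n) (0\<^sub>m n 1) V"
  define g where "g k = (case k of 0 \<Rightarrow> Re e | Suc k \<Rightarrow> f k)" for k
  have Pc: "P \<in> carrier_mat ?N ?N"
    unfolding P_def using four_block_carrier_mat[of "1\<^sub>m 1" 1 1 V n n] Vc by simp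
  have Pa: "mat_adjoint P = four_block_mat (1\<^sub>m 1) (0\<^sub>m 1 n) (0\<^sub>m n 1) (mat_adjoint V)"
    unfolding P_def using Vc by (intro eq_matI) auto
  have P: "unitary_mat ?N P"
  proof (rule unitary_matI[OF Pc])
    show "mat_adjoint P * P = 1\<^sub>m ?N"
      unfolding Pa unfolding P_def using Vc V
      using four_block_one_mat[of 1 n, unfolded plus_1_eq_Suc]
      by (simp add: mult_block_diag unitary_mat_def plus_1_eq_Suc del: One_nat_def)
  qed
  have dg: "real_diag ?N g = four_block_mat (mat 1 1 (\<lambda>_. e)) (0\<^sub>m 1 n) (0\<^sub>m n 1) (real_diag n f)"
    using e by (intro eq_matI) (auto simp: real_diag_def mat_diag_def g_def split: nat.split)
  have "P * real_diag ?N g * mat_adjoint P =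
    four_block_mat (mat 1 1 (\<lambda>_. e)) (0\<^sub>m 1 n) (0\<^sub>m n 1) (V * real_diag n f * mat_adjoint V)"
    unfolding Pa dg unfolding P_def using Vc
    by (simp add: mult_block_diag del: One_nat_def)
  also have "\<dots> = A'"
    unfolding A3[symmetric] using A'c
  proof (intro eq_matI, goal_cases)
    case (1 i j)
    then show ?case using A'0[of i] A'0'[of j] \<open>e = cnj e\<close>
      by (cases i; cases j) (auto simp: A3_def)
  qed (auto simp: A3_def)
  finally have "A = W * (P * real_diag ?N g * mat_adjoint P) * mat_adjoint W"
    unfolding A'_def using unitary_mat_cancel[OF W Suc.prems(1)] by simp
  also have "\<dots> = (W * P) * real_diag ?N g * mat_adjoint (W * P)"
    using Wc Pc by (simp add: mat_adjoint_mult[OF Wc Pc]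
      square_mult_assoc[where n="?N"])
  finally show ?case
    using unitary_mat_mult[OF W P] by blast
qed

section \<open>Eigenvalue sums and the Frobenius inner product\<close>

lemma proots_prod_list_linear:
  fixes as :: "complex list"
  shows "proots (\<Prod>a\<leftarrow>as. [:- a, 1:]) = mset as"
proof (induction as)
  case (Cons a as)
  have "(\<Prod>a\<leftarrow>as. [:- a, 1:]) \<noteq> 0"
    by (auto simp: prod_list_zero_iff)
  with Cons show ?case
    by (simp add: proots_mult del: mult_pCons_left)
qed simp

text \<open>Links \<open>tr_fun\<close> to a spectral decomposition: similar matrices share their
  characteristic polynomial, and that of a diagonal matrix has the diagonal entries as roots, with
  multiplicity.\<close>

lemma tr_fun_unitary_diag:
  assumes V: "unitary_mat n V"
  shows "tr_fun h (V * real_diag n f * mat_adjoint V) = (\<Sum>k<n. h (f k))"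
proof -
  have c: "V \<in> carrier_mat n n" using V by (simp add: unitary_mat_def)
  have "similar_mat_wit (V * real_diag n f * mat_adjoint V) (real_diag n f) V (mat_adjoint V)"
    using V c by (intro similar_mat_witI[of _ _ n]) (auto simp: unitary_mat_def)
  then have "char_poly (V * real_diag n f * mat_adjoint V) = char_poly (real_diag n f)"
    by (intro char_poly_similar) (auto simp: similar_mat_def)
  also have "\<dots> = (\<Prod>a\<leftarrow>diag_mat (real_diag n f). [:- a, 1:])"
    by (rule char_poly_upper_triangular[of _ n]) (auto simp: real_diag_def mat_diag_def)
  finally have "proots (char_poly (V * real_diag n f * mat_adjoint V)) = mset (diag_mat (real_diag n f))"
    by (simp only: proots_prod_list_linear)
  also have "diag_mat (real_diag n f) = map (\<lambda>i. complex_of_real (f i)) [0..<n]"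
    by (auto simp: diag_mat_def real_diag_def mat_diag_def)
  finally show ?thesis
    by (simp add: tr_fun_def sum_mset_sum_list sum_list_distinct_conv_sum_set o_def
        atLeast0LessThan flip: mset_map)
qed

text \<open>This is the real part of the trace of \<open>A * mat_adjoint B\<close>, hence tr(A B)
  when \<open>B\<close> is Hermitian. The entrywise form permits the final comparison to be made one
  entry at a time.\<close>

definition frob_inner :: "nat \<Rightarrow> complex mat \<Rightarrow> complex mat \<Rightarrow> real" where
  "frob_inner n A B = (\<Sum>i<n. \<Sum>j<n. Re (A $$ (i, j) * cnj (B $$ (i, j))))"

lemma frob_inner_adjoint:
  assumes "A \<in> carrier_mat n n" "B \<in> carrier_mat n n"
  shows "frob_inner n (mat_adjoint A) (mat_adjoint B) = frob_inner n A B"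
proof -
  have "frob_inner n (mat_adjoint A) (mat_adjoint B)
      = (\<Sum>i<n. \<Sum>j<n. Re (A $$ (j, i) * cnj (B $$ (j, i))))"
    unfolding frob_inner_def using assms by (intro sum.cong) auto
  also have "\<dots> = frob_inner n A B"
    unfolding frob_inner_def by (rule sum.swap)
  finally show ?thesis .
qed

lemma frob_inner_mult_left:
  assumes "V \<in> carrier_mat n n" "A \<in> carrier_mat n n" "B \<in> carrier_mat n n"
  shows "frob_inner n (V * A) B = frob_inner n A (mat_adjoint V * B)"
proof -
  have "frob_inner n (V * A) B
      = Re (\<Sum>i<n. \<Sum>j<n. \<Sum>k<n. V $$ (i, k) * A $$ (k, j) * cnj (B $$ (i, j)))"
    using assms by (simp add: frob_inner_def scalar_prod_def sum_distrib_right atLeast0LessThan)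
  also have "(\<Sum>i<n. \<Sum>j<n. \<Sum>k<n. V $$ (i, k) * A $$ (k, j) * cnj (B $$ (i, j)))
      = (\<Sum>j<n. \<Sum>k<n. \<Sum>i<n. V $$ (i, k) * A $$ (k, j) * cnj (B $$ (i, j)))"
    by (rule trans[OF sum.swap]) (intro sum.cong refl sum.swap)
  also have "\<dots> = (\<Sum>k<n. \<Sum>j<n. \<Sum>i<n. V $$ (i, k) * A $$ (k, j) * cnj (B $$ (i, j)))"
    by (rule sum.swap)
  also have "Re \<dots> = frob_inner n A (mat_adjoint V * B)"
    using assms by (simp add: frob_inner_def scalar_prod_def sum_distrib_left atLeast0LessThan mult_ac)
  finally show ?thesis .
qed

text \<open>Taking adjoints in both arguments reverses products, which reduces this to
  multiplication on the left.\<close>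

lemma frob_inner_mult_right:
  assumes "V \<in> carrier_mat n n" "A \<in> carrier_mat n n" "B \<in> carrier_mat n n"
  shows "frob_inner n (A * V) B = frob_inner n A (B * mat_adjoint V)"
proof -
  have "frob_inner n (A * V) B = frob_inner n (mat_adjoint V * mat_adjoint A) (mat_adjoint B)"
    using assms frob_inner_adjoint[of "A * V" n B] by (simp add: mat_adjoint_mult[of A n n V n])
  also have "\<dots> = frob_inner n (mat_adjoint A) (mat_adjoint (B * mat_adjoint V))"
    using assms by (simp add: frob_inner_mult_left mat_adjoint_mult[of B n n "mat_adjoint V" n])
  also have "\<dots> = frob_inner n A (B * mat_adjoint V)"
    using assms by (intro frob_inner_adjoint) auto
  finally show ?thesis .
qed

text \<open>Both outer factors can be moved to the second argument, where they cancel. This allows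
  inner products to be computed in an eigenbasis.\<close>

lemma frob_inner_unitary:
  assumes V: "unitary_mat n V" and A: "A \<in> carrier_mat n n" and B: "B \<in> carrier_mat n n"
  shows "frob_inner n (V * A * mat_adjoint V) (V * B * mat_adjoint V) = frob_inner n A B"
proof -
  have c: "V \<in> carrier_mat n n" using V by (simp add: unitary_mat_def)
  have "frob_inner n (V * A * mat_adjoint V) (V * B * mat_adjoint V)
      = frob_inner n A (mat_adjoint V * (V * B * mat_adjoint V * V))"
    using c A B frob_inner_mult_right[of "mat_adjoint V" n "V * A" "V * B * mat_adjoint V"]
      frob_inner_mult_left[of V n A "V * B * mat_adjoint V * V"] by simp
  also have "mat_adjoint V * (V * B * mat_adjoint V * V) = (mat_adjoint V * V) * B * (mat_adjoint V * V)"
    using c B by (simp add: square_mult_assoc[where n=n])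
  also have "\<dots> = B"
    using V B by (simp add: unitary_mat_def)
  finally show ?thesis .
qed

lemma frob_inner_real_diag_right:
  "frob_inner n A (real_diag n f) = (\<Sum>k<n. Re (A $$ (k, k)) * f k)"
proof -
  have "(\<Sum>j<n. Re (A $$ (i, j) * cnj (real_diag n f $$ (i, j)))) = Re (A $$ (i, i)) * f i" if "i < n" for i
    using that by (subst sum.remove[of _ i]) (auto simp: real_diag_def mat_diag_def)
  then show ?thesis
    by (simp add: frob_inner_def)
qed

section \<open>Quadratic forms and upper bounds on them\<close>

lemma inner_adjoint:
  fixes A :: "complex mat"
  assumes "A \<in> carrier_mat n n" "x \<in> carrier_vec n" "y \<in> carrier_vec n"
  shows "(A *\<^sub>v x) \<bullet>c y = x \<bullet>c (mat_adjoint A *\<^sub>v y)"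
proof -
  have "(A *\<^sub>v x) \<bullet>c y = (\<Sum>i<n. \<Sum>k<n. A $$ (i, k) * x $ k * cnj (y $ i))"
    using assms by (simp add: scalar_prod_def sum_distrib_right atLeast0LessThan)
  also have "\<dots> = (\<Sum>k<n. \<Sum>i<n. A $$ (i, k) * x $ k * cnj (y $ i))"
    by (rule sum.swap)
  also have "\<dots> = x \<bullet>c (mat_adjoint A *\<^sub>v y)"
    using assms by (simp add: scalar_prod_def sum_distrib_left atLeast0LessThan mult_ac)
  finally show ?thesis .
qed

lemma Re_mult_cnj_self: "Re (z * cnj z) = (cmod z)\<^sup>2"
  unfolding cmod_power2 by (simp add: power2_eq_square)

lemma norm_sq_vec:
  fixes x :: "complex vec"
  assumes "x \<in> carrier_vec n"
  shows "Re (x \<bullet>c x) = (\<Sum>i<n. (cmod (x $ i))\<^sup>2)"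
  using assms by (simp add: scalar_prod_def atLeast0LessThan Re_mult_cnj_self del: complex_mult_cnj times_complex.sel)

lemma real_diag_quadratic:
  assumes "x \<in> carrier_vec n"
  shows "Re ((real_diag n f *\<^sub>v x) \<bullet>c x) = (\<Sum>i<n. f i * (cmod (x $ i))\<^sup>2)"
proof -
  have "(real_diag n f *\<^sub>v x) $ i = of_real (f i) * x $ i" if "i < n" for i
    using assms that
    by (simp add: real_diag_def mat_diag_def scalar_prod_def sum.remove[of _ i] if_distrib cong: if_cong)
  then have "(real_diag n f *\<^sub>v x) \<bullet>c x = (\<Sum>i<n. of_real (f i) * (x $ i * cnj (x $ i)))"
    using assms by (simp add: scalar_prod_def atLeast0LessThan mult_ac)
  also have "\<dots> = of_real (\<Sum>i<n. f i * (cmod (x $ i))\<^sup>2)"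
    by (simp add: complex_norm_square del: of_real_power)
  finally show ?thesis by simp
qed

text \<open>Meaningful for Hermitian matrices, where it says that every eigenvalue is at most \<open>c\<close>.\<close>

definition quad_le :: "nat \<Rightarrow> complex mat \<Rightarrow> real \<Rightarrow> bool" where
  "quad_le n A c \<longleftrightarrow> (\<forall>x \<in> carrier_vec n. Re ((A *\<^sub>v x) \<bullet>c x) \<le> c * Re (x \<bullet>c x))"

text \<open>In the coordinates \<open>y = mat_adjoint V *\<^sub>v x\<close> the form is diagonal
  with coefficients at most \<open>c\<close>, and the change of coordinates preserves the
  norm.\<close>

lemma quad_le_unitary_diag:
  assumes V: "unitary_mat n V" and f: "\<And>k. k < n \<Longrightarrow> f k \<le> c"
  shows "quad_le n (V * real_diag n f * mat_adjoint V) c"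
  unfolding quad_le_def
proof
  fix x :: "complex vec" assume x: "x \<in> carrier_vec n"
  have Vc: "V \<in> carrier_mat n n" using V by (simp add: unitary_mat_def)
  define y where "y = mat_adjoint V *\<^sub>v x"
  have y: "y \<in> carrier_vec n" unfolding y_def using Vc x by (intro mult_mat_vec_carrier[of _ n n]) auto
  have "V * real_diag n f * mat_adjoint V *\<^sub>v x = V *\<^sub>v (real_diag n f *\<^sub>v y)"
    using Vc x by (simp add: y_def assoc_mult_mat_vec[where ?n\<^sub>1=n and ?n\<^sub>2=n and ?n\<^sub>3=n]
        mult_mat_vec_carrier[of _ n n])
  then have "(V * real_diag n f * mat_adjoint V *\<^sub>v x) \<bullet>c x = (real_diag n f *\<^sub>v y) \<bullet>c y"
    using Vc x y by (simp add: inner_adjoint[where n=n] mult_mat_vec_carrier[of _ n n] flip: y_def)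
  then have "Re ((V * real_diag n f * mat_adjoint V *\<^sub>v x) \<bullet>c x) = (\<Sum>i<n. f i * (cmod (y $ i))\<^sup>2)"
    using y by (simp add: real_diag_quadratic)
  also have "\<dots> \<le> (\<Sum>i<n. c * (cmod (y $ i))\<^sup>2)"
    using f by (intro sum_mono mult_right_mono) auto
  also have "\<dots> = c * Re (y \<bullet>c y)"
    using y by (simp add: norm_sq_vec sum_distrib_left)
  also have "y \<bullet>c y = (V *\<^sub>v y) \<bullet>c x"
    using Vc x y by (simp add: inner_adjoint[where n=n] flip: y_def)
  also have "V *\<^sub>v y = (V * mat_adjoint V) *\<^sub>v x"
    using Vc x by (simp add: y_def assoc_mult_mat_vec[where ?n\<^sub>1=n and ?n\<^sub>2=n and ?n\<^sub>3=n])
  also have "\<dots> = x"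
    using V x by (simp add: unitary_mat_def)
  finally show "Re ((V * real_diag n f * mat_adjoint V *\<^sub>v x) \<bullet>c x) \<le> c * Re (x \<bullet>c x)" .
qed

section \<open>Variational bounds for the two traces\<close>

lemma phi_ge_tangent:
  assumes "z \<le> c"
  shows "phi c x \<ge> 2 * z * x - z\<^sup>2"
proof (cases "x \<le> c")
  case True
  have "0 \<le> (x - z)\<^sup>2" by simp
  with True show ?thesis by (simp add: phi_def power2_eq_square algebra_simps)
next
  case False
  \<comment> \<open>On the linear branch the difference of the two sides factors as (c - z)(2 x - c
    - z), and the second factor is the sum of x - c and x - z.\<close>
  have "0 \<le> (c - z) * ((x - c) + (x - z))"
    using False assms by (intro mult_nonneg_nonneg) auto
  with False show ?thesis by (simp add: phi_def power2_eq_square algebra_simps)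
qed

text \<open>In an eigenbasis of \<open>A\<close> the pairing with \<open>A\<close> sees only the
  diagonal of the transformed \<open>Z\<close>. Its entries have real part at most \<open>c\<close>,
  so the scalar tangent bound applies at every eigenvalue, and replacing the full Frobenius norm by
  the diagonal real parts only helps.\<close>

lemma tr_phi_ge:
  assumes A: "A \<in> carrier_mat n n" "hermitian_mat A"
    and Z: "Z \<in> carrier_mat n n" "quad_le n Z c"
  shows "tr_fun (phi c) A \<ge> 2 * frob_inner n Z A - frob_inner n Z Z"
proof -
  obtain V f where V: "unitary_mat n V" and Aeq: "A = V * real_diag n f * mat_adjoint V"
    using hermitian_spectral[OF A] by blast
  have Vc: "V \<in> carrier_mat n n" using V by (simp add: unitary_mat_def)
  define N where "N = mat_adjoint V * Z * V"
  have Nc: "N \<in> carrier_mat n n" using Vc Z by (simp add: N_def)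
  have Zeq: "Z = V * N * mat_adjoint V"
    unfolding N_def using unitary_mat_cancel[OF V Z(1)] by simp
  \<comment> \<open>The entry \<open>N $$ (k, k)\<close> is the quadratic form of \<open>Z\<close>
    at the unit vector \<open>col V k\<close>.\<close>
  have N_le: "Re (N $$ (k, k)) \<le> c" if k: "k < n" for k
  proof -
    have ck: "col V k \<in> carrier_vec n" using Vc k by auto
    have "N $$ (k, k) = (mat_adjoint V * (Z * V)) $$ (k, k)"
      unfolding N_def using Vc Z by (simp add: square_mult_assoc[where n=n])
    also have "\<dots> = (Z *\<^sub>v col V k) \<bullet>c col V k"
      using Vc Z k by (simp add: scalar_prod_def mult.commute)
    also have "Re \<dots> \<le> c * Re (col V k \<bullet>c col V k)"
      using Z(2) ck by (simp add: quad_le_def)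
    also have "col V k \<bullet>c col V k = (mat_adjoint V * V) $$ (k, k)"
      using Vc k by (simp add: scalar_prod_def mult.commute)
    also have "\<dots> = 1"
      using V k by (simp add: unitary_mat_def)
    finally show ?thesis by simp
  qed
  have ZA: "frob_inner n Z A = (\<Sum>k<n. Re (N $$ (k, k)) * f k)"
    unfolding Zeq Aeq using Nc by (simp add: frob_inner_unitary[OF V] frob_inner_real_diag_right)
  have "(\<Sum>k<n. (Re (N $$ (k, k)))\<^sup>2) \<le> frob_inner n N N"
    unfolding frob_inner_def
  proof (rule sum_mono)
    fix i assume i: "i \<in> {..<n}"
    have "(Re (N $$ (i, i)))\<^sup>2 \<le> Re (N $$ (i, i) * cnj (N $$ (i, i)))"
      by (simp add: power2_eq_square)
    also have "\<dots> \<le> (\<Sum>j<n. Re (N $$ (i, j) * cnj (N $$ (i, j))))"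
      using i by (intro member_le_sum) auto
    finally show "(Re (N $$ (i, i)))\<^sup>2 \<le> (\<Sum>j<n. Re (N $$ (i, j) * cnj (N $$ (i, j))))" .
  qed
  also have "frob_inner n N N = frob_inner n Z Z"
    unfolding Zeq using Nc by (simp add: frob_inner_unitary[OF V])
  finally have ZZ: "(\<Sum>k<n. (Re (N $$ (k, k)))\<^sup>2) \<le> frob_inner n Z Z" .
  have "(\<Sum>k<n. 2 * Re (N $$ (k, k)) * f k - (Re (N $$ (k, k)))\<^sup>2) \<le> (\<Sum>k<n. phi c (f k))"
    using N_le by (intro sum_mono phi_ge_tangent) auto
  then have "2 * frob_inner n Z A - (\<Sum>k<n. (Re (N $$ (k, k)))\<^sup>2) \<le> (\<Sum>k<n. phi c (f k))"
    by (simp add: ZA sum_subtractf sum_distrib_left mult.assoc)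
  with ZZ show ?thesis
    unfolding Aeq tr_fun_unitary_diag[OF V] by linarith
qed

text \<open>The value \<open>Psi \<tau> x\<close> equals 2 w (x - 1) - w^2 at w = min (x - 1)
  \<tau>. Applying this truncation to the eigenvalues of \<open>U\<close> while keeping its
  eigenvectors gives \<open>W\<close>.\<close>

lemma tr_Psi_attained:
  assumes U: "U \<in> carrier_mat n n" "hermitian_mat U"
  obtains W where "W \<in> carrier_mat n n" "quad_le n W \<tau>"
    "tr_fun (Psi \<tau>) U = 2 * frob_inner n W (U - 1\<^sub>m n) - frob_inner n W W"
proof -
  obtain V f where V: "unitary_mat n V" and Ueq: "U = V * real_diag n f * mat_adjoint V"
    using hermitian_spectral[OF U] by blast
  have Vc: "V \<in> carrier_mat n n" using V by (simp add: unitary_mat_def)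
  define w where "w k = min (f k - 1) \<tau>" for k
  define W where "W = V * real_diag n w * mat_adjoint V"
  \<comment> \<open>Subtracting the identity shifts the eigenvalues and keeps \<open>V\<close>, so
    \<open>W\<close> and \<open>U - 1\<^sub>m n\<close> are diagonal in the same basis.\<close>
  have "real_diag n (\<lambda>k. f k - 1) = real_diag n f - 1\<^sub>m n"
    by (rule eq_matI) (auto simp: real_diag_def mat_diag_def)
  then have "V * real_diag n (\<lambda>k. f k - 1) * mat_adjoint V
    = V * real_diag n f * mat_adjoint V - V * mat_adjoint V"
    using Vc by (simp add: mult_minus_distrib_mat[of _ n n _ n] minus_mult_distrib_mat[of _ n n _ _ n])
  then have U1: "U - 1\<^sub>m n = V * real_diag n (\<lambda>k. f k - 1) * mat_adjoint V"
    using V by (simp add: Ueq unitary_mat_def)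
  have WU: "frob_inner n W (U - 1\<^sub>m n) = (\<Sum>k<n. w k * (f k - 1))"
    unfolding U1 W_def frob_inner_unitary[OF V real_diag_carrier real_diag_carrier] frob_inner_real_diag_right
    by (simp add: real_diag_def mat_diag_def)
  have WW: "frob_inner n W W = (\<Sum>k<n. w k * w k)"
    unfolding W_def frob_inner_unitary[OF V real_diag_carrier real_diag_carrier] frob_inner_real_diag_right
    by (simp add: real_diag_def mat_diag_def)
  have "Psi \<tau> (f k) = 2 * (w k * (f k - 1)) - w k * w k" for k
    by (auto simp: Psi_def w_def min_def power2_eq_square algebra_simps)
  moreover have "tr_fun (Psi \<tau>) U = (\<Sum>k<n. Psi \<tau> (f k))"
    unfolding Ueq by (rule tr_fun_unitary_diag[OF V])
  ultimately have "tr_fun (Psi \<tau>) U = 2 * frob_inner n W (U - 1\<^sub>m n) - frob_inner n W W"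
    unfolding WU WW by (simp add: sum_subtractf sum_distrib_left)
  moreover have "quad_le n W \<tau>"
    unfolding W_def by (rule quad_le_unitary_diag[OF V]) (simp add: w_def)
  moreover have "W \<in> carrier_mat n n" using Vc by (simp add: W_def)
  ultimately show ?thesis using that by blast
qed

section \<open>Diagonal scaling and the comparison of \<open>G\<close> with \<open>U\<close>\<close>

lemma real_diag_congruence_index:
  assumes "A \<in> carrier_mat n n" "i < n" "j < n"
  shows "(real_diag n f * A * real_diag n f) $$ (i, j) = of_real (f i * f j) * A $$ (i, j)"
  using assms
  by (simp add: real_diag_def mat_diag_mult_left[of _ n n] mat_diag_mult_right[of _ n n] mult_ac)

text \<open>The gap to the value at 1 is (d - 1)(\<tau> - d)/d, and the gap to the value at 2 is (2
  - d)(2 d - \<tau>)/(2 d). The first is nonnegative for d \<le> \<tau>, the second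
  otherwise.\<close>

lemma add_div_le_max:
  fixes d \<tau> :: real
  assumes "1 \<le> d" "d \<le> 2" "\<tau> \<ge> 0"
  shows "d + \<tau> / d \<le> max (1 + \<tau>) (2 + \<tau> / 2)"
proof (cases "d \<le> \<tau>")
  case True
  have "0 \<le> (d - 1) * (\<tau> - d)"
    using assms True by (intro mult_nonneg_nonneg) auto
  then have "d + \<tau> / d \<le> 1 + \<tau>"
    using assms by (simp add: field_simps)
  then show ?thesis by simp
next
  case False
  have "0 \<le> (2 - d) * (2 * d - \<tau>)"
    using assms False by (intro mult_nonneg_nonneg) auto
  then have "d + \<tau> / d \<le> 2 + \<tau> / 2"
    using assms by (simp add: field_simps)
  then show ?thesis by simp
qed

theorem theorem2:
  fixes l :: nat
    and U D G :: "complex mat"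
    and d :: "nat \<Rightarrow> real"
    and \<tau> c :: real
  assumes "U \<in> carrier_mat l l"
    and "hermitian_mat U"
    and "\<And>i. i < l \<Longrightarrow> U $$ (i, i) = 1"
    and "\<And>i. i < l \<Longrightarrow> 1 \<le> d i \<and> d i \<le> 2"
    and "D = real_diag l d"
    and "G = real_diag l (\<lambda>i. sqrt (d i)) * U * real_diag l (\<lambda>i. sqrt (d i))"
    and "\<tau> \<ge> 0"
    and "c \<ge> max (1 + \<tau>) (2 + \<tau> / 2)"
  shows "tr_fun (phi c) G - Re (mat_trace (D ^\<^sub>m 2)) \<ge> tr_fun (Psi \<tau>) U"
proof -
  obtain W where W: "W \<in> carrier_mat l l" "quad_le l W \<tau>"
    and Psi_eq: "tr_fun (Psi \<tau>) U = 2 * frob_inner l W (U - 1\<^sub>m l) - frob_inner l W W"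
    using tr_Psi_attained[OF assms(1,2)] by blast
  \<comment> \<open>\<open>s\<close> is the diagonal of the inverse square root of \<open>D\<close>,
    so \<open>F\<close> undoes on \<open>W\<close> the scaling that leads from \<open>U\<close> to
    \<open>G\<close>.\<close>
  define s where "s i = 1 / sqrt (d i)" for i
  define F where "F = real_diag l s * W * real_diag l s"
  define Z where "Z = D + F"
  have Fc: "F \<in> carrier_mat l l" using W by (simp add: F_def)
  have Zc: "Z \<in> carrier_mat l l" using Fc by (simp add: Z_def assms(5))
  have Gc: "G \<in> carrier_mat l l" using assms(1) by (simp add: assms(6))
  have G_ij: "G $$ (i, j) = of_real (sqrt (d i) * sqrt (d j)) * U $$ (i, j)" if "i < l" "j < l" for i j
    unfolding assms(6) using that assms(1) by (intro real_diag_congruence_index)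
  have Z_ij: "Z $$ (i, j) = (if i = j then of_real (d i) else 0) + of_real (s i * s j) * W $$ (i, j)"
    if "i < l" "j < l" for i j
  proof -
    have "F $$ (i, j) = of_real (s i * s j) * W $$ (i, j)"
      unfolding F_def using W(1) that by (rule real_diag_congruence_index)
    then show ?thesis
      using that Fc by (auto simp: Z_def assms(5) real_diag_def mat_diag_def)
  qed
  have Gh: "hermitian_mat G"
    using Gc
  proof (rule hermitian_matI)
    fix i j assume "i < l" "j < l"
    then show "G $$ (i, j) = cnj (G $$ (j, i))"
      using hermitian_mat_index[OF assms(2,1), of i j] by (simp add: G_ij mult_ac)
  qed
  have sa: "mat_adjoint (real_diag l s) = real_diag l s"
    by (rule eq_matI) (auto simp: real_diag_def mat_diag_def)
  \<comment> \<open>With \<open>y = real_diag l s *\<^sub>v x\<close>, the form of \<open>F\<close>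
    at \<open>x\<close> is that of \<open>W\<close> at \<open>y\<close>, hence at most \<tau> times
    the squared norm of \<open>y\<close>. In coordinates this bounds \<open>Z\<close> by the
    diagonal matrix with entries d_i + \<tau>/d_i, where \<open>add_div_le_max\<close>
    applies.\<close>
  have "quad_le l Z c"
    unfolding quad_le_def
  proof
    fix x :: "complex vec" assume x: "x \<in> carrier_vec l"
    define y where "y = real_diag l s *\<^sub>v x"
    have y: "y \<in> carrier_vec l" unfolding y_def
      using x by (intro mult_mat_vec_carrier[of _ l l]) auto
    have Wy: "W *\<^sub>v y \<in> carrier_vec l" using W(1) y by (rule mult_mat_vec_carrier)
    have Fx: "F *\<^sub>v x = real_diag l s *\<^sub>v (W *\<^sub>v y)"
      unfolding F_def y_def using W(1) x
      by (simp add: assoc_mult_mat_vec[where ?n\<^sub>1=l and ?n\<^sub>2=l and ?n\<^sub>3=l]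
          mult_mat_vec_carrier[of _ l l])
    have "(F *\<^sub>v x) \<bullet>c x = (W *\<^sub>v y) \<bullet>c y"
      unfolding Fx inner_adjoint[OF real_diag_carrier Wy x] sa y_def[symmetric] ..
    then have "Re ((F *\<^sub>v x) \<bullet>c x) \<le> \<tau> * Re (y \<bullet>c y)"
      using W(2) y by (simp add: quad_le_def)
    also have "y \<bullet>c y = (real_diag l (\<lambda>i. s i * s i) *\<^sub>v x) \<bullet>c x"
    proof -
      have "y \<bullet>c y = (real_diag l s *\<^sub>v y) \<bullet>c x"
        unfolding inner_adjoint[OF real_diag_carrier y x] sa y_def[symmetric] ..
      also have "real_diag l s *\<^sub>v y = (real_diag l s * real_diag l s) *\<^sub>v x"
        unfolding y_def using x by (simp add: assoc_mult_mat_vec[where ?n\<^sub>1=l and ?n\<^sub>2=l and ?n\<^sub>3=l])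
      also have "real_diag l s * real_diag l s = real_diag l (\<lambda>i. s i * s i)"
        by (simp add: real_diag_def)
      finally show ?thesis .
    qed
    also have "Re \<dots> = (\<Sum>i<l. s i * s i * (cmod (x $ i))\<^sup>2)"
      by (rule real_diag_quadratic[OF x])
    finally have F_le: "Re ((F *\<^sub>v x) \<bullet>c x) \<le> (\<Sum>i<l. \<tau> * (s i * s i * (cmod (x $ i))\<^sup>2))"
      by (simp add: sum_distrib_left)
    have Dx: "D *\<^sub>v x \<in> carrier_vec l" "F *\<^sub>v x \<in> carrier_vec l"
      using x Fc by (auto simp: assms(5) intro: mult_mat_vec_carrier[of _ l l])
    have "Z *\<^sub>v x = D *\<^sub>v x + F *\<^sub>v x"
      unfolding Z_def assms(5) using x Fc by (intro add_mult_distrib_mat_vec) auto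
    then have "(Z *\<^sub>v x) \<bullet>c x = (D *\<^sub>v x) \<bullet>c x + (F *\<^sub>v x) \<bullet>c x"
      using x Dx by (simp add: add_scalar_prod_distrib[of _ l])
    then have "Re ((Z *\<^sub>v x) \<bullet>c x) = (\<Sum>i<l. d i * (cmod (x $ i))\<^sup>2) + Re ((F *\<^sub>v x) \<bullet>c x)"
      using real_diag_quadratic[OF x, of d] by (simp add: assms(5))
    also have "\<dots> \<le> (\<Sum>i<l. d i * (cmod (x $ i))\<^sup>2) + (\<Sum>i<l. \<tau> * (s i * s i * (cmod (x $ i))\<^sup>2))"
      using F_le by simp
    also have "\<dots> = (\<Sum>i<l. (d i + \<tau> * (s i * s i)) * (cmod (x $ i))\<^sup>2)"
      by (simp add: sum.distrib algebra_simps)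
    also have "\<dots> \<le> (\<Sum>i<l. c * (cmod (x $ i))\<^sup>2)"
    proof (intro sum_mono mult_right_mono)
      fix i assume "i \<in> {..<l}"
      then have di: "1 \<le> d i" "d i \<le> 2" using assms(4) by auto
      then have "\<tau> * (s i * s i) = \<tau> / d i"
        by (simp add: s_def)
      then show "d i + \<tau> * (s i * s i) \<le> c"
        using add_div_le_max[OF di assms(7)] assms(8) by linarith
    qed simp
    also have "\<dots> = c * Re (x \<bullet>c x)"
      using x by (simp add: norm_sq_vec sum_distrib_left)
    finally show "Re ((Z *\<^sub>v x) \<bullet>c x) \<le> c * Re (x \<bullet>c x)" .
  qed
  then have phi_ge: "tr_fun (phi c) G \<ge> 2 * frob_inner l Z G - frob_inner l Z Z"
    using tr_phi_ge[OF Gc Gh Zc] by simp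
  have "D ^\<^sub>m 2 = real_diag l (\<lambda>i. d i * d i)"
    by (simp add: assms(5) numeral_2_eq_2) (simp add: real_diag_def)
  then have "mat_trace (D ^\<^sub>m 2) = sum_list (map (\<lambda>i. complex_of_real (d i * d i)) [0..<l])"
    unfolding mat_trace_def diag_mat_def
    by (intro arg_cong[where f = sum_list] map_cong) (auto simp: real_diag_def mat_diag_def)
  then have trD: "Re (mat_trace (D ^\<^sub>m 2)) = (\<Sum>i<l. d i * d i)"
    by (simp add: sum_list_distinct_conv_sum_set atLeast0LessThan)
  \<comment> \<open>The required trace inequality already holds entry by entry; charging
    \<open>d i * d i\<close> to the diagonal entries makes these terms add up to the trace of the
    square of \<open>D\<close>.\<close>
  have entry: "2 * Re (W $$ (i, j) * cnj ((U - 1\<^sub>m l) $$ (i, j))) - Re (W $$ (i, j) * cnj (W $$ (i, j)))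
      \<le> 2 * Re (Z $$ (i, j) * cnj (G $$ (i, j))) - Re (Z $$ (i, j) * cnj (Z $$ (i, j)))
        - (if i = j then d i * d i else 0)"
    if ij: "i < l" "j < l" for i j
  proof -
    have pos: "d i \<ge> 1" "d j \<ge> 1" using assms(4) ij by auto
    \<comment> \<open>\<open>t\<close> is the factor of \<open>W $$ (i, j)\<close> in
      \<open>Z\<close>. It is the reciprocal of the factor of \<open>U $$ (i, j)\<close> in
      \<open>G\<close>, and d_i, d_j \<ge> 1 keeps it in [0, 1].\<close>
    define t where "t = s i * s j"
    have "sqrt (d i) \<ge> 1" "sqrt (d j) \<ge> 1" using pos by auto
    then have t: "0 \<le> t" "t \<le> 1" "t * (sqrt (d i) * sqrt (d j)) = 1"
      using mult_mono[of 1 "sqrt (d i)" 1 "sqrt (d j)"] by (auto simp: t_def s_def field_simps)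
    let ?w = "W $$ (i, j)"
    have t2: "t * t * (cmod ?w)\<^sup>2 \<le> (cmod ?w)\<^sup>2"
      using t mult_mono[of t 1 t 1] by (intro mult_left_le_one_le) auto
    show ?thesis
    proof (cases "i = j")
      case True
      have Zii: "Z $$ (i, i) = of_real (d i) + of_real t * ?w"
        using Z_ij[of i i] ij True by (simp add: t_def)
      have Gii: "G $$ (i, i) = of_real (d i)"
        using G_ij[of i i] ij pos True assms(3)
        by (simp flip: of_real_mult)
      \<comment> \<open>Since the diagonal entry of \<open>G\<close> is exactly \<open>d i\<close>,
        both the terms linear in \<open>?w\<close> and the multiples of the square of
        \<open>d i\<close> cancel. The claim reduces to comparing - t^2 |w|^2 with - |w|^2.\<close>
      have "2 * Re (Z $$ (i, i) * cnj (G $$ (i, i))) - (cmod (Z $$ (i, i)))\<^sup>2 - d i * d i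
        = - (t * t * (cmod ?w)\<^sup>2)"
        unfolding Zii Gii cmod_power2 by (simp add: power2_eq_square algebra_simps)
      moreover have "(U - 1\<^sub>m l) $$ (i, i) = 0"
        using ij assms(1,3) True by simp
      ultimately show ?thesis
        using t2 True unfolding Re_mult_cnj_self by simp
    next
      case False
      have Zij: "Z $$ (i, j) = of_real t * ?w"
        using Z_ij[OF ij] False by (simp add: t_def)
      \<comment> \<open>Off the diagonal the two scalings cancel in the pairing with
        \<open>G\<close>, while the squared modulus of the entry of \<open>Z\<close> is that of
        \<open>?w\<close> shrunk by t^2.\<close>
      have "Z $$ (i, j) * cnj (G $$ (i, j))
          = of_real (t * (sqrt (d i) * sqrt (d j))) * (?w * cnj (U $$ (i, j)))"
        unfolding Zij G_ij[OF ij] by simp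
      then have "Z $$ (i, j) * cnj (G $$ (i, j)) = ?w * cnj (U $$ (i, j))"
        unfolding t(3) by simp
      moreover have "(cmod (Z $$ (i, j)))\<^sup>2 = t * t * (cmod ?w)\<^sup>2"
        unfolding Zij by (simp add: norm_mult power2_eq_square)
      moreover have "(U - 1\<^sub>m l) $$ (i, j) = U $$ (i, j)"
        using ij assms(1) False by simp
      ultimately show ?thesis
        using t2 False unfolding Re_mult_cnj_self by simp
    qed
  qed
  have "2 * frob_inner l W (U - 1\<^sub>m l) - frob_inner l W W
    = (\<Sum>i<l. \<Sum>j<l. 2 * Re (W $$ (i, j) * cnj ((U - 1\<^sub>m l) $$ (i, j))) - Re (W $$ (i, j) * cnj (W $$ (i, j))))"
    unfolding frob_inner_def sum_subtractf sum_distrib_left ..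
  also have "\<dots> \<le> (\<Sum>i<l. \<Sum>j<l. 2 * Re (Z $$ (i, j) * cnj (G $$ (i, j)))
      - Re (Z $$ (i, j) * cnj (Z $$ (i, j))) - (if i = j then d i * d i else 0))"
    by (intro sum_mono entry) auto
  also have "\<dots> = 2 * frob_inner l Z G - frob_inner l Z Z - (\<Sum>i<l. \<Sum>j<l. if i = j then d i * d i else 0)"
    unfolding frob_inner_def sum_subtractf sum_distrib_left ..
  also have "(\<Sum>i<l. \<Sum>j<l. if i = j then d i * d i else 0) = (\<Sum>i<l. d i * d i)"
    by (simp add: sum.delta)
  finally show ?thesis
    using phi_ge trD Psi_eq by linarith
qed

end
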